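(* Let $r\in\left(1,\frac{1+\sqrt5}{2}\right)$ and $s\in\mathbb C$ with $\mathrm{Re}(s)>\frac12$, and let $\mathcal L_s$ be the Mayer transfer operator for $PGL(2,\mathbb Z)$ on $B(D_r)$. For integers $m,k\ge0$ put $$a_{mk}(s)=\sum_{j=0}^k\binom kj\frac{(-1)^{m+k-j}}{m!}\,\frac{\Gamma(2s+j+m)}{\Gamma(2s+j)}\,\big(\zeta(2s+j+m)-1\big),$$ where $\zeta$ is the Riemann zeta function. (i) If $f\in B(D_r)$ is an eigenfunction, $\mathcal L_sf=\lambda f$, with Taylor expansion $f(z)=\sum_{k=0}^\infty c_k(z-1)^k$ on $D_r$, then the sequence $(c_k)_{k\ge0}$ satisfies $$\sum_{k=0}^\infty a_{mk}(s)\,c_k=\lambda c_m\qquad\text{for all } m\ge0 .$$ (ii) In the basis $\{(z-1)^k\}_{k=0}^\infty$ the operator $\mathcal L_s$ is represented by the infinite matrix $(a_{mk}(s))_{m,k\ge0}$, i.e. for each $k\ge0$ the image under $\mathcal L_s$ of the function $z\mapsto(z-1)^k$ has the expansion $\sum_{m=0}^\infty a_{mk}(s)(z-1)^m$ on $D_r$.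
   Context: For $r>0$ put $D_r=\{z\in\mathbb C: |z-1|<r\}$, and let $B(D_r)$ be the Banach space of functions that are holomorphic on $D_r$ and continuous on $\overline{D}_r$, with the sup norm. For $r\in(1,\frac{1+\sqrt5}{2})$ and $\mathrm{Re}(s)>\frac12$ the Mayer transfer operator for $PGL(2,\mathbb Z)$ is $$\mathcal L_sf(z)=\sum_{n=1}^\infty\Big(\frac1{z+n}\Big)^{2s}f\Big(\frac1{z+n}\Big),\qquad f\in B(D_r)$$ (principal branch of the power; $\mathrm{Re}(z+n)>0$ on $\overline D_r$). It maps $B(D_r)$ to itself. *)

theory Defs
  imports "HOL-Complex_Analysis.Complex_Analysis"
begin

text \<open>
  An element of \<open>B(D\<^sub>r)\<close> is represented by a total function of which only the values on the closed
  disc \<open>cball 1 r\<close> matter. Since \<open>cball 1 r\<close> is compact, the sup norm needs no separate condition.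
\<close>

definition mayer_space :: "real \<Rightarrow> (complex \<Rightarrow> complex) set" where
  "mayer_space r = {f. f holomorphic_on ball 1 r \<and> continuous_on (cball 1 r) f}"

text \<open>
  The sum over \<open>n \<ge> 1\<close> is indexed by \<open>Suc n\<close>. For \<open>Re s > 1/2\<close>, \<open>1 < r < (1 + sqrt 5) / 2\<close>,
  \<open>f \<in> mayer_space r\<close> and \<open>z \<in> cball 1 r\<close>, the points \<open>1 / (z + n)\<close> lie in \<open>cball 1 r\<close> and the
  series converges absolutely.
\<close>

definition mayer_op :: "complex \<Rightarrow> (complex \<Rightarrow> complex) \<Rightarrow> complex \<Rightarrow> complex" where
  "mayer_op s f z =
     (\<Sum>n. (1 / (z + of_nat (Suc n))) powr (2 * s) * f (1 / (z + of_nat (Suc n))))"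

definition mayer_eigenfunction ::
    "real \<Rightarrow> complex \<Rightarrow> complex \<Rightarrow> (complex \<Rightarrow> complex) \<Rightarrow> bool" where
  "mayer_eigenfunction r s \<mu> f \<longleftrightarrow>
     f \<in> mayer_space r \<and> (\<exists>z\<in>cball 1 r. f z \<noteq> 0) \<and>
     (\<forall>z\<in>cball 1 r. mayer_op s f z = \<mu> * f z)"

text \<open>
  The Riemann zeta function on its half-plane of absolute convergence \<open>Re w > 1\<close>. No continuation
  is involved: below, \<open>w = 2 * s + j + m\<close> with \<open>Re s > 1/2\<close>.
\<close>

definition riemann_zeta :: "complex \<Rightarrow> complex" where
  "riemann_zeta w = (\<Sum>n. 1 / of_nat (Suc n) powr w)"

definition mayer_coeff :: "complex \<Rightarrow> nat \<Rightarrow> nat \<Rightarrow> complex" where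
  "mayer_coeff s m k =
     (\<Sum>j=0..k. of_nat (k choose j) * ((-1) ^ (m + k - j) / fact m) *
        (Gamma (2 * s + of_nat j + of_nat m) / Gamma (2 * s + of_nat j)) *
        (riemann_zeta (2 * s + of_nat j + of_nat m) - 1))"

end

theory Submission
  imports Defs
begin

text \<open>
  The maps \<open>z \<mapsto> 1 / (z + n)\<close> send the disc \<open>D\<^sub>r\<close> into a fixed disc about \<open>1\<close> of radius less
  than \<open>r\<close>: this is exactly where \<open>r\<^sup>2 < r + 1\<close> enters. The weights \<open>(z + n) powr (- 2 * s)\<close> are
  bounded on \<open>D\<^sub>r\<close> by a summable sequence. Hence for \<open>f(z) = (z - 1) ^ k\<close> the defining series
  converges uniformly on \<open>D\<^sub>r\<close> and may be expanded at \<open>1\<close> term by term: the \<open>m\<close>-th Taylor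
  coefficient of \<open>(z + n) powr (- a)\<close> is \<open>(-1) ^ m / m! * \<Gamma>(a + m) / \<Gamma>(a) * (n + 1) powr (- a - m)\<close>,
  and summation over \<open>n \<ge> 1\<close> produces \<open>\<zeta>(a + m) - 1\<close>. For a general \<open>f\<close>, the Taylor polynomials
  converge uniformly on the smaller disc, so their images converge uniformly on \<open>D\<^sub>r\<close>, and by
  Cauchy's estimates the Taylor coefficients of the images converge as well.
\<close>

section \<open>Taylor coefficients of uniformly convergent series\<close>

lemma higher_deriv_sum:
  fixes f :: "'b \<Rightarrow> complex \<Rightarrow> complex"
  assumes "finite I" "\<And>i. i \<in> I \<Longrightarrow> f i holomorphic_on A" "open A" "z \<in> A"
  shows "(deriv ^^ m) (\<lambda>w. \<Sum>i\<in>I. f i w) z = (\<Sum>i\<in>I. (deriv ^^ m) (f i) z)"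
  using assms(1,2)
proof (induction I rule: finite_induct)
  case (insert i I)
  have "(deriv ^^ m) (\<lambda>w. f i w + (\<Sum>j\<in>I. f j w)) z
      = (deriv ^^ m) (f i) z + (deriv ^^ m) (\<lambda>w. \<Sum>j\<in>I. f j w) z"
    using insert assms by (intro higher_deriv_add[of _ A]) (auto intro!: holomorphic_intros)
  then show ?case using insert by simp
qed simp

text \<open>Uniform convergence of holomorphic functions on an open set passes to every derivative.
  This is used for two different sums: the one over \<open>n\<close> defining the operator, and the
  one over \<open>k\<close> in the expansion of \<open>f\<close>.\<close>

lemma higher_deriv_sums_uniform:
  fixes f :: "nat \<Rightarrow> complex \<Rightarrow> complex"
  assumes "\<And>n. f n holomorphic_on A" "open A" "z \<in> A"
    and "uniform_limit A (\<lambda>N w. \<Sum>n<N. f n w) g sequentially"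
  shows "(\<lambda>n. (deriv ^^ m) (f n) z) sums (deriv ^^ m) g z"
proof -
  have "(\<lambda>N. (deriv ^^ m) (\<lambda>w. \<Sum>n<N. f n w) z) \<longlonglongrightarrow> (deriv ^^ m) g z"
    using assms by (intro higher_deriv_complex_uniform_limit always_eventually allI)
      (auto intro!: holomorphic_intros)
  moreover have "(deriv ^^ m) (\<lambda>w. \<Sum>n<N. f n w) z = (\<Sum>n<N. (deriv ^^ m) (f n) z)" for N
    using assms by (intro higher_deriv_sum[of _ _ A]) auto
  ultimately show ?thesis unfolding sums_def by simp
qed

lemma holomorphic_uniform_limit_open:
  assumes "open A" "\<And>n. f n holomorphic_on A" "uniform_limit A f g sequentially"
  shows "g holomorphic_on A"
proof (rule holomorphic_uniform_sequence[OF assms(1,2)])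
  fix x assume "x \<in> A"
  then obtain d where "d > 0" "cball x d \<subseteq> A"
    using assms(1) open_contains_cball by blast
  then show "\<exists>d>0. cball x d \<subseteq> A \<and> uniform_limit (cball x d) f g sequentially"
    using uniform_limit_on_subset[OF assms(3)] by blast
qed

text \<open>A convergent expansion has only one possible set of coefficients. Translating
  \<open>z\<close> to the origin makes this a fact about formal power series expansions.\<close>

lemma power_series_coeff_eq_higher_deriv:
  fixes c :: "nat \<Rightarrow> complex"
  assumes "r > 0" "\<And>w. w \<in> ball z r \<Longrightarrow> (\<lambda>k. c k * (w - z) ^ k) sums f w"
  shows "(deriv ^^ m) f z = fact m * c m"
proof -
  have "(\<lambda>u. f (z + u)) has_fps_expansion Abs_fps c"
  proof (rule has_fps_expansionI)
    have "eventually (\<lambda>u. u \<in> ball 0 r) (nhds (0::complex))"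
      using assms(1) by (intro eventually_nhds_in_open) auto
    then show "eventually (\<lambda>u. (\<lambda>n. fps_nth (Abs_fps c) n * u ^ n) sums f (z + u)) (nhds 0)"
    proof eventually_elim
      case (elim u)
      then show ?case using assms(2)[of "z + u"] by (simp add: dist_norm)
    qed
  qed
  from fps_nth_fps_expansion[OF this, of m]
  have "c m = (deriv ^^ m) (\<lambda>u. f (z + u)) 0 / fact m" by simp
  moreover have "(deriv ^^ m) f z = (deriv ^^ m) (\<lambda>u. f (z + u)) 0"
    using higher_deriv_shift_0[of m f z] by (simp add: o_def)
  ultimately show ?thesis by simp
qed

section \<open>Derivatives at 1 of the single terms for \<open>(z - 1) ^ k\<close>\<close>

lemma higher_deriv_shifted_powr:
  fixes a c z :: complex
  assumes "Re (z + c) > 0"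
  shows "(deriv ^^ m) (\<lambda>w. (w + c) powr (- a)) z
           = (-1) ^ m * pochhammer a m * (z + c) powr (- a - of_nat m)"
  using assms
proof (induction m arbitrary: z)
  case (Suc m)
  \<comment> \<open>The induction hypothesis is about to be differentiated, so it must hold on a
    whole neighbourhood of \<open>z\<close>.\<close>
  have ev: "eventually (\<lambda>w. Re (w + c) > 0) (nhds z)"
  proof -
    have "open {w. Re (w + c) > 0}" by (intro open_Collect_less continuous_intros)
    from eventually_nhds_in_open[OF this, of z] Suc.prems show ?thesis by simp
  qed
  have nr: "z + c \<notin> \<real>\<^sub>\<le>\<^sub>0" using Suc.prems by (auto simp: complex_nonpos_Reals_iff)
  have "(deriv ^^ Suc m) (\<lambda>w. (w + c) powr (- a)) z
      = deriv (\<lambda>w. (-1) ^ m * pochhammer a m * (w + c) powr (- a - of_nat m)) z"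
    unfolding funpow.simps o_def
    by (rule deriv_cong_ev[OF eventually_mono[OF ev Suc.IH]]) auto
  also have "\<dots> = (-1) ^ m * pochhammer a m *
      ((- a - of_nat m) * (z + c) powr (- a - of_nat m - 1))"
    by (rule DERIV_imp_deriv) (use nr in \<open>auto intro!: derivative_eq_intros has_field_derivative_powr[THEN DERIV_chain2]\<close>)
  also have "\<dots> = (-1) ^ Suc m * pochhammer a (Suc m) * (z + c) powr (- a - of_nat (Suc m))"
    by (simp add: pochhammer_Suc algebra_simps)
  finally show ?case .
qed simp

text \<open>The summand of \<open>mayer_op\<close> applied to
  \<open>\<lambda>w. (w - 1) ^ k\<close>.\<close>

definition mayer_term :: "complex \<Rightarrow> nat \<Rightarrow> nat \<Rightarrow> complex \<Rightarrow> complex" where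
  "mayer_term s k n z =
     (1 / (z + of_nat (Suc n))) powr (2 * s) * (1 / (z + of_nat (Suc n)) - 1) ^ k"

text \<open>Off the closed negative real axis the principal logarithm satisfies Ln(1/v) = -Ln v, so
  no branch correction appears.\<close>

lemma inverse_powr_complex:
  fixes v a :: complex
  assumes "Re v > 0"
  shows "(1 / v) powr a = v powr (- a)"
proof -
  have "v \<notin> \<real>\<^sub>\<le>\<^sub>0" using assms by (auto simp: complex_nonpos_Reals_iff)
  moreover have "v \<noteq> 0" using assms by auto
  ultimately show ?thesis using Ln_inverse[of v] by (simp add: powr_def inverse_eq_divide)
qed

text \<open>With v = z + n + 1, expanding (1/v - 1)^k turns the summand into a finite combination of
  pure powers of v, which can be differentiated explicitly. This is the source of the sum over
  \<open>j\<close> in \<open>mayer_coeff\<close>.\<close>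

lemma mayer_term_binomial:
  assumes "Re (z + of_nat (Suc n)) > 0"
  shows "mayer_term s k n z = (\<Sum>j=0..k. of_nat (k choose j) * (-1) ^ (k - j) *
           (z + of_nat (Suc n)) powr (- (2 * s + of_nat j)))"
proof -
  define v where "v = z + of_nat (Suc n)"
  have "Re v > 0" using assms by (simp add: v_def)
  then have v: "Re v > 0" "v \<noteq> 0" by auto
  have p: "v powr (- (2 * s + of_nat j)) = v powr (- (2 * s)) * (1 / v) ^ j" for j
  proof -
    have "v powr (- (2 * s + of_nat j)) = v powr (- (2 * s) - of_nat j)" by simp
    also have "\<dots> = v powr (- (2 * s)) / v powr of_nat j" by (rule powr_diff)
    also have "\<dots> = v powr (- (2 * s)) * (1 / v) ^ j"
      using v by (simp only: powr_nat power_one_over if_False times_divide_eq_right mult_1_right)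
    finally show ?thesis .
  qed
  have "mayer_term s k n z = v powr (- (2 * s)) * (1 / v + (- 1)) ^ k"
    unfolding mayer_term_def v_def[symmetric] inverse_powr_complex[OF v(1)] by simp
  also have "\<dots> = v powr (- (2 * s)) *
      (\<Sum>j\<le>k. of_nat (k choose j) * (1 / v) ^ j * (- 1) ^ (k - j))"
    by (simp only: binomial_ring)
  also have "\<dots> = (\<Sum>j=0..k. of_nat (k choose j) * (-1) ^ (k - j) * v powr (- (2 * s + of_nat j)))"
    unfolding p sum_distrib_left atMost_atLeast0 by (simp add: mult_ac)
  finally show ?thesis by (simp add: v_def)
qed

lemma mayer_term_holomorphic:
  assumes "\<And>z. z \<in> A \<Longrightarrow> Re (z + of_nat (Suc n)) > 0"
  shows "mayer_term s k n holomorphic_on A"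
proof -
  have "(\<lambda>z. \<Sum>j=0..k. of_nat (k choose j) * (-1) ^ (k - j) *
           (z + of_nat (Suc n)) powr (- (2 * s + of_nat j))) holomorphic_on A"
    using assms by (auto intro!: holomorphic_intros simp: complex_nonpos_Reals_iff
      simp del: of_nat_Suc) force
  then show ?thesis
    by (rule holomorphic_transform) (use assms mayer_term_binomial in auto)
qed

lemma higher_deriv_mayer_term_at_1:
  "(deriv ^^ m) (mayer_term s k n) 1 =
     (\<Sum>j=0..k. of_nat (k choose j) * (-1) ^ (k - j) *
       ((-1) ^ m * pochhammer (2 * s + of_nat j) m *
         (1 / of_nat (Suc (Suc n)) powr (2 * s + of_nat j + of_nat m))))"
proof -
  \<comment> \<open>Only derivatives at 1 matter here, so the right half-plane serves as an open
    domain independent of \<open>r\<close>.\<close>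
  define A where "A = {z::complex. Re z > 0}"
  have A: "open A" "1 \<in> A" by (auto simp: A_def open_halfspace_Re_gt)
  have pos: "Re (z + of_nat (Suc n)) > 0" if "z \<in> A" for z using that by (auto simp: A_def)
  have nr: "z + of_nat (Suc n) \<notin> \<real>\<^sub>\<le>\<^sub>0" if "z \<in> A" for z
    using pos[OF that] by (auto simp: complex_nonpos_Reals_iff)
  have hol: "(\<lambda>z. (z + of_nat (Suc n)) powr (- a)) holomorphic_on A" for a
    using nr by (auto intro!: holomorphic_intros simp del: of_nat_Suc)
  have "(deriv ^^ m) (mayer_term s k n) 1 =
     (deriv ^^ m) (\<lambda>z. \<Sum>j=0..k. of_nat (k choose j) * (-1) ^ (k - j) *
           (z + of_nat (Suc n)) powr (- (2 * s + of_nat j))) 1"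
    by (intro higher_deriv_transform_within_open[OF _ _ A] mayer_term_holomorphic
        mayer_term_binomial holomorphic_on_sum holomorphic_on_mult holomorphic_on_const hol pos)
  also have "\<dots> = (\<Sum>j=0..k. (deriv ^^ m) (\<lambda>z. of_nat (k choose j) * (-1) ^ (k - j) *
           (z + of_nat (Suc n)) powr (- (2 * s + of_nat j))) 1)"
    by (intro higher_deriv_sum[OF _ _ A] holomorphic_on_mult holomorphic_on_const hol) simp
  also have "\<dots> = (\<Sum>j=0..k. of_nat (k choose j) * (-1) ^ (k - j) *
      ((-1) ^ m * pochhammer (2 * s + of_nat j) m *
         (1 / of_nat (Suc (Suc n)) powr (2 * s + of_nat j + of_nat m))))"
  proof (rule sum.cong[OF refl])
    fix j
    have "(deriv ^^ m) (\<lambda>z. of_nat (k choose j) * (-1) ^ (k - j) *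
           (z + of_nat (Suc n)) powr (- (2 * s + of_nat j))) 1 =
        of_nat (k choose j) * (-1) ^ (k - j) *
          (deriv ^^ m) (\<lambda>z. (z + of_nat (Suc n)) powr (- (2 * s + of_nat j))) 1"
      by (rule higher_deriv_cmult[OF hol[of "2 * s + of_nat j"] A(2,1)])
    also have "(deriv ^^ m) (\<lambda>z. (z + of_nat (Suc n)) powr (- (2 * s + of_nat j))) 1 =
        (-1) ^ m * pochhammer (2 * s + of_nat j) m *
          (1 + of_nat (Suc n)) powr (- (2 * s + of_nat j) - of_nat m)"
      by (rule higher_deriv_shifted_powr) simp
    \<comment> \<open>Evaluation at z = 1 makes the base n + 2, so the bases run through 2, 3, ...
      and miss the first term of zeta.\<close>
    also have "(1 + of_nat (Suc n)) powr (- (2 * s + of_nat j) - of_nat m) =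
        1 / of_nat (Suc (Suc n)) powr (2 * s + of_nat j + of_nat m)"
      using powr_minus_divide[of "of_nat (Suc (Suc n))" "2 * s + of_nat j + of_nat m"]
      by (simp add: algebra_simps)
    finally show "(deriv ^^ m) (\<lambda>z. of_nat (k choose j) * (-1) ^ (k - j) *
           (z + of_nat (Suc n)) powr (- (2 * s + of_nat j))) 1 =
       of_nat (k choose j) * (-1) ^ (k - j) *
      ((-1) ^ m * pochhammer (2 * s + of_nat j) m *
         (1 / of_nat (Suc (Suc n)) powr (2 * s + of_nat j + of_nat m)))" .
  qed
  finally show ?thesis .
qed

section \<open>From the summed derivatives to the matrix entries\<close>

lemma riemann_zeta_minus_1_sums:
  assumes "Re w > 1"
  shows "(\<lambda>n. 1 / of_nat (Suc (Suc n)) powr w) sums (riemann_zeta w - 1)"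
proof -
  have "summable (\<lambda>n. real n powr (- Re w))"
    using assms by (subst summable_real_powr_iff) simp
  then have "summable (\<lambda>n. of_nat n powr (- w) :: complex)"
    by (intro summable_norm_cancel[where f = "\<lambda>n. of_nat n powr (- w)"])
      (simp add: norm_powr_real_powr)
  then have "summable (\<lambda>n. of_nat (Suc n) powr (- w) :: complex)"
    by (subst summable_Suc_iff)
  then have "(\<lambda>n. 1 / of_nat (Suc n) powr w) sums riemann_zeta w"
    unfolding riemann_zeta_def powr_minus_divide by (rule summable_sums)
  \<comment> \<open>The discarded term at index 0 is 1 / 1 powr \<open>w\<close> = 1.\<close>
  then show ?thesis
    by (subst sums_Suc_iff[where f = "\<lambda>n. 1 / of_nat (Suc n) powr w"]) simp
qed

lemma higher_deriv_mayer_term_sums: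
  assumes "Re s > 1 / 2"
  shows "(\<lambda>n. (deriv ^^ m) (mayer_term s k n) 1) sums (fact m * mayer_coeff s m k)"
proof -
  have "(\<lambda>n. (deriv ^^ m) (mayer_term s k n) 1) sums
     (\<Sum>j=0..k. of_nat (k choose j) * (-1) ^ (k - j) *
       ((-1) ^ m * pochhammer (2 * s + of_nat j) m *
         (riemann_zeta (2 * s + of_nat j + of_nat m) - 1)))"
    unfolding higher_deriv_mayer_term_at_1
    by (intro sums_sum sums_mult riemann_zeta_minus_1_sums) (use assms in simp)
  also have "\<dots> = fact m * mayer_coeff s m k"
    unfolding mayer_coeff_def sum_distrib_left
  proof (rule sum.cong[OF refl])
    fix j assume j: "j \<in> {0..k}"
    \<comment> \<open>Positive real part avoids the poles of Gamma, so the Pochhammer symbol is a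
      genuine Gamma quotient.\<close>
    have "Re (2 * s + of_nat j) > 0" using assms by simp
    then have "2 * s + of_nat j \<notin> \<int>\<^sub>\<le>\<^sub>0" by (auto elim!: nonpos_Ints_cases' simp: complex_eq_iff)
    from pochhammer_Gamma[OF this, of m]
    have "pochhammer (2 * s + of_nat j) m
        = Gamma (2 * s + of_nat j + of_nat m) / Gamma (2 * s + of_nat j)" .
    \<comment> \<open>The subtraction is truncated; \<open>j\<close> \<le> \<open>k\<close> is what
      allows the exponent to be split.\<close>
    moreover have "(-1::complex) ^ (m + k - j) = (-1) ^ (k - j) * (-1) ^ m"
      using j by (simp add: power_add[symmetric] add.commute)
    ultimately show "of_nat (k choose j) * (-1) ^ (k - j) *
       ((-1) ^ m * pochhammer (2 * s + of_nat j) m *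
         (riemann_zeta (2 * s + of_nat j + of_nat m) - 1)) =
      fact m * (of_nat (k choose j) * ((-1) ^ (m + k - j) / fact m) *
        (Gamma (2 * s + of_nat j + of_nat m) / Gamma (2 * s + of_nat j)) *
        (riemann_zeta (2 * s + of_nat j + of_nat m) - 1))"
      by simp
  qed
  finally show ?thesis .
qed

section \<open>Estimates for the weights and inverse branches on the disc\<close>

lemma Re_shift_ge:
  assumes "z \<in> cball 1 r"
  shows "Re (z + of_nat (Suc n)) \<ge> 2 - r + of_nat n"
proof -
  have "Re (1 - z) \<le> r" using assms complex_Re_le_cmod[of "1 - z"] by (simp add: dist_norm)
  then show ?thesis by simp
qed

lemma golden_less_2:
  fixes r :: real
  assumes "r < (1 + sqrt 5) / 2"
  shows "r < 2"
proof -
  have "sqrt 5 < (3::real)" by (rule real_less_lsqrt) auto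
  then have "(1 + sqrt 5) / 2 < (2::real)" by simp
  with assms show ?thesis by (rule less_trans)
qed

text \<open>For v = z + n + 1 the weight has modulus |v|^(-2 Re s) exp(2 Im s Arg v). The
  exponential is bounded since |Arg v| \<le> pi, and |v| grows at least linearly in n + 1, so 2 Re s
  > 1 gives summability.\<close>

lemma mayer_weight_bound:
  assumes "r < 2" "Re s > 1 / 2"
  obtains M where "summable M"
    "\<And>n z. z \<in> cball (1::complex) r \<Longrightarrow> norm ((1 / (z + of_nat (Suc n))) powr (2 * s)) \<le> M n"
proof
  \<comment> \<open>Chosen so that d (n + 1) \<le> 2 - r + n for all n: \<open>d\<close> \<le> 2 -
    \<open>r\<close> handles the constant and \<open>d\<close> \<le> 1 the multiple of n.\<close>
  define d where "d = min 1 (2 - r)"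
  have d: "d > 0" "d \<le> 1" "d \<le> 2 - r" using assms by (auto simp: d_def)
  define M where "M n = exp (2 * \<bar>Im s\<bar> * pi) * d powr (- 2 * Re s) * real (Suc n) powr (- 2 * Re s)" for n
  have "summable (\<lambda>n. real n powr (- 2 * Re s))"
    using assms by (subst summable_real_powr_iff) simp
  then show "summable M"
    unfolding M_def by (intro summable_mult) (subst summable_Suc_iff)
  fix n and z :: complex assume z: "z \<in> cball 1 r"
  define v where "v = z + of_nat (Suc n)"
  have "d * real (Suc n) = d + d * real n" by (simp add: algebra_simps)
  also have "\<dots> \<le> 2 - r + real n" using d mult_right_mono[of d 1 "real n"] by simp
  also have "\<dots> \<le> Re v" unfolding v_def by (rule Re_shift_ge[OF z])
  finally have Rev: "d * real (Suc n) \<le> Re v" .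
  then have Rep: "Re v > 0" using d by (smt (verit) mult_pos_pos of_nat_0_less_iff zero_less_Suc)
  have le: "d * real (Suc n) \<le> norm v" using Rev complex_Re_le_cmod[of v] by linarith
  have "norm ((1 / v) powr (2 * s)) = norm v powr (- 2 * Re s) * exp (2 * Im s * Arg v)"
    unfolding inverse_powr_complex[OF Rep] norm_powr_complex by simp
  also have "\<dots> \<le> (d * real (Suc n)) powr (- 2 * Re s) * exp (2 * \<bar>Im s\<bar> * pi)"
  proof (intro mult_mono)
    show "norm v powr (- 2 * Re s) \<le> (d * real (Suc n)) powr (- 2 * Re s)"
      by (rule powr_mono2') (use assms d le in auto)
    have "Im s * Arg v \<le> \<bar>Im s\<bar> * \<bar>Arg v\<bar>" by (metis abs_ge_self abs_mult)
    also have "\<dots> \<le> \<bar>Im s\<bar> * pi" using Arg_bounded[of v] by (intro mult_left_mono) auto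
    finally show "exp (2 * Im s * Arg v) \<le> exp (2 * \<bar>Im s\<bar> * pi)" by simp
  qed auto
  also have "\<dots> = M n" using d by (simp add: M_def powr_mult mult_ac)
  finally show "norm ((1 / (z + of_nat (Suc n))) powr (2 * s)) \<le> M n" by (simp add: v_def)
qed

text \<open>
  Inversion maps the half-plane \<open>Re v \<ge> d\<close> into the disc with diameter \<open>[0, 1 / d]\<close>; here
  \<open>d = 2 - r\<close>, and \<open>1 / d - 1 < r\<close> says that \<open>r\<close> is below the golden ratio.
\<close>

lemma mayer_branch_contraction:
  assumes "1 < r" "r < (1 + sqrt 5) / 2"
  obtains \<rho> where "0 < \<rho>" "\<rho> < r"
    "\<And>n z. z \<in> cball 1 r \<Longrightarrow> 1 / (z + of_nat (Suc n)) \<in> cball (1::complex) \<rho>"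
proof
  note r2 = golden_less_2[OF assms(2)]
  have s5: "sqrt 5 * sqrt 5 = (5::real)" "sqrt 5 > (1::real)" by auto
  \<comment> \<open>The factorization of r^2 - r - 1 over its two roots.\<close>
  have "(r - (1 + sqrt 5) / 2) * (r - (1 - sqrt 5) / 2) < 0"
    by (rule mult_neg_pos) (use assms s5 in \<open>auto simp: field_simps\<close>)
  then have golden: "r * r < r + 1" using s5 by (simp add: field_simps)
  define d where "d = 2 - r"
  have d: "d > 0" "d < 1" using r2 assms by (auto simp: d_def)
  \<comment> \<open>The points of the disc with diameter [0, 1/d] farthest from 1 lie among 0 and
    1/d, at distances 1 and |1/d - 1|.\<close>
  define \<rho> where "\<rho> = max 1 (1 / d - 1)"
  show "0 < \<rho>" by (simp add: \<rho>_def)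
  have "1 / d - 1 < r" using d golden by (simp add: d_def field_simps)
  then show "\<rho> < r" using assms by (simp add: \<rho>_def)
  fix n and z :: complex assume "z \<in> cball 1 r"
  define v where "v = z + of_nat (Suc n)"
  have Rev: "Re v \<ge> d" using Re_shift_ge[OF \<open>z \<in> cball 1 r\<close>, of n] by (simp add: v_def d_def)
  then have v0: "v \<noteq> 0" using d by auto
  \<comment> \<open>The line Re v = d is the perpendicular bisector of 0 and 2d. Dividing the
    distance comparison by |2dv| gives the disc of centre and radius 1/(2d).\<close>
  have "(norm (2 * of_real d - v))\<^sup>2 \<le> (norm v)\<^sup>2"
  proof -
    have "(norm v)\<^sup>2 - (norm (2 * of_real d - v))\<^sup>2 = 4 * d * (Re v - d)"
      by (simp only: cmod_power2) (simp add: power2_eq_square algebra_simps)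
    also have "\<dots> \<ge> 0" using d Rev by simp
    finally show ?thesis by simp
  qed
  then have "norm (2 * of_real d - v) \<le> norm v" by (rule power2_le_imp_le) simp
  moreover have "1 / v - of_real (1 / (2 * d)) = (2 * of_real d - v) / (2 * of_real d * v)"
    using v0 d by (simp add: field_simps)
  ultimately have "norm (1 / v - of_real (1 / (2 * d))) \<le> 1 / (2 * d)"
    using v0 d by (simp add: norm_divide norm_mult field_simps)
  moreover have "norm (1 / v - 1) \<le> norm (1 / v - of_real (1 / (2 * d))) + norm (of_real (1 / (2 * d)) - 1 :: complex)"
    using norm_triangle_ineq[of "1 / v - of_real (1 / (2 * d))" "of_real (1 / (2 * d)) - 1"] by simp
  moreover have "norm (of_real (1 / (2 * d)) - 1 :: complex) = \<bar>1 / (2 * d) - 1\<bar>"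
    by (metis norm_of_real of_real_1 of_real_diff)
  ultimately have "norm (1 / v - 1) \<le> \<rho>"
    unfolding \<rho>_def by (auto simp: abs_if max_def split: if_splits)
  then show "1 / (z + of_nat (Suc n)) \<in> cball 1 \<rho>"
    by (simp add: v_def dist_norm norm_minus_commute)
qed

section \<open>Convergence and boundedness of the operator\<close>

lemma mayer_op_uniform_limit:
  assumes "r < 2" "Re s > 1 / 2"
    and f: "\<And>n z. z \<in> cball 1 r \<Longrightarrow> norm (f (1 / (z + of_nat (Suc n)))) \<le> B"
  shows "uniform_limit (cball 1 r)
    (\<lambda>N z. \<Sum>n<N. (1 / (z + of_nat (Suc n))) powr (2 * s) * f (1 / (z + of_nat (Suc n))))
    (mayer_op s f) sequentially"
proof -
  obtain M where M: "summable M"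
    "\<And>n z. z \<in> cball 1 r \<Longrightarrow> norm ((1 / (z + of_nat (Suc n))) powr (2 * s)) \<le> M n"
    using mayer_weight_bound[OF assms(1,2)] by blast
  show ?thesis
    unfolding mayer_op_def
  proof (rule Weierstrass_m_test)
    show "summable (\<lambda>n. M n * B)" using M(1) by (rule summable_mult2)
    fix n z assume z: "z \<in> cball (1::complex) r"
    show "norm ((1 / (z + of_nat (Suc n))) powr (2 * s) * f (1 / (z + of_nat (Suc n)))) \<le> M n * B"
      unfolding norm_mult
      by (rule mult_mono'[OF M(2)[OF z] f[OF z]]) auto
  qed
qed

text \<open>Summing the weight bounds gives one constant for all \<open>f\<close>. Since
  \<open>B\<close> bounds \<open>f\<close> only at the points 1/(z + n + 1), smallness on the
  contracted disc controls the image on all of \<open>cball 1 r\<close>.\<close>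

lemma mayer_op_bound:
  assumes "0 < r" "r < 2" "Re s > 1 / 2"
  obtains C where "0 < C"
    "\<And>f B z. z \<in> cball 1 r \<Longrightarrow> (\<And>n. norm (f (1 / (z + of_nat (Suc n)))) \<le> B) \<Longrightarrow>
       norm (mayer_op s f z) \<le> C * B"
proof -
  obtain M where M: "summable M"
    "\<And>n z. z \<in> cball 1 r \<Longrightarrow> norm ((1 / (z + of_nat (Suc n))) powr (2 * s)) \<le> M n"
    using mayer_weight_bound[OF assms(2,3)] by blast
  have M0: "M n \<ge> 0" for n
    using order_trans[OF norm_ge_zero M(2)[of 1 n]] assms(1) by simp
  show thesis
  proof (rule that)
    \<comment> \<open>Adding 1 makes the constant strictly positive, so that it can later be divided
      by.\<close>
    show "0 < suminf M + 1" using suminf_nonneg[OF M(1) M0] by simp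
    fix f :: "complex \<Rightarrow> complex" and B z
    assume z: "z \<in> cball 1 r" and f: "\<And>n. norm (f (1 / (z + of_nat (Suc n)))) \<le> B"
    have "norm (mayer_op s f z) \<le> (\<Sum>n. M n * B)"
      unfolding mayer_op_def
    proof (rule norm_suminf_le)
      show "summable (\<lambda>n. M n * B)" using M(1) by (rule summable_mult2)
      show "norm ((1 / (z + of_nat (Suc n))) powr (2 * s) * f (1 / (z + of_nat (Suc n)))) \<le> M n * B" for n
        unfolding norm_mult by (rule mult_mono'[OF M(2)[OF z] f]) auto
    qed
    also have "\<dots> = suminf M * B" using suminf_mult2[OF M(1)] by simp
    also have "\<dots> \<le> (suminf M + 1) * B"
      using order_trans[OF norm_ge_zero f] by (simp add: algebra_simps)
    finally show "norm (mayer_op s f z) \<le> (suminf M + 1) * B" .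
  qed
qed

section \<open>Images of the basis functions\<close>

lemma norm_shifted_power_le:
  assumes "w \<in> cball (1::complex) \<rho>"
  shows "norm ((w - 1) ^ k) \<le> \<rho> ^ k"
  using assms by (auto simp: norm_power dist_norm norm_minus_commute intro!: power_mono)

lemma mayer_op_shifted_power:
  assumes "1 < r" "r < (1 + sqrt 5) / 2" "Re s > 1 / 2"
  shows "mayer_op s (\<lambda>w. (w - 1) ^ k) holomorphic_on ball 1 r"
    and "(deriv ^^ m) (mayer_op s (\<lambda>w. (w - 1) ^ k)) 1 = fact m * mayer_coeff s m k"
proof -
  note r2 = golden_less_2[OF assms(2)]
  obtain \<rho> where "0 < \<rho>" "\<rho> < r" and
    \<rho>: "\<And>n z. z \<in> cball 1 r \<Longrightarrow> 1 / (z + of_nat (Suc n)) \<in> cball (1::complex) \<rho>"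
    using mayer_branch_contraction[OF assms(1,2)] by blast
  have "uniform_limit (cball 1 r) (\<lambda>N z. \<Sum>n<N. mayer_term s k n z)
      (mayer_op s (\<lambda>w. (w - 1) ^ k)) sequentially"
    unfolding mayer_term_def
    by (rule mayer_op_uniform_limit[OF r2 assms(3)]) (rule norm_shifted_power_le[OF \<rho>])
  then have lim: "uniform_limit (ball 1 r) (\<lambda>N z. \<Sum>n<N. mayer_term s k n z)
      (mayer_op s (\<lambda>w. (w - 1) ^ k)) sequentially"
    by (rule uniform_limit_on_subset) auto
  have hol: "mayer_term s k n holomorphic_on ball 1 r" for n
  proof (rule mayer_term_holomorphic)
    fix z :: complex assume "z \<in> ball 1 r"
    then have "z \<in> cball 1 r" by auto
    from Re_shift_ge[OF this, of n] r2 show "0 < Re (z + of_nat (Suc n))" by linarith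
  qed
  show "mayer_op s (\<lambda>w. (w - 1) ^ k) holomorphic_on ball 1 r"
    by (rule holomorphic_uniform_limit_open[OF _ _ lim]) (auto intro!: holomorphic_on_sum hol)
  have "(\<lambda>n. (deriv ^^ m) (mayer_term s k n) 1) sums
      (deriv ^^ m) (mayer_op s (\<lambda>w. (w - 1) ^ k)) 1"
    by (rule higher_deriv_sums_uniform[OF hol _ _ lim]) (use assms in auto)
  \<comment> \<open>The same series of derivatives has been summed twice: by uniform convergence and
    by explicit computation.\<close>
  from sums_unique2[OF this higher_deriv_mayer_term_sums[OF assms(3)]]
  show "(deriv ^^ m) (mayer_op s (\<lambda>w. (w - 1) ^ k)) 1 = fact m * mayer_coeff s m k" .
qed

section \<open>Images of general power series\<close>

lemma mayer_op_power_series: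
  assumes "1 < r" "r < (1 + sqrt 5) / 2" "Re s > 1 / 2"
    and f: "\<And>z. z \<in> ball 1 r \<Longrightarrow> (\<lambda>k. c k * (z - 1) ^ k) sums f z"
  shows "uniform_limit (ball 1 r) (\<lambda>K z. \<Sum>k<K. c k * mayer_op s (\<lambda>w. (w - 1) ^ k) z)
           (mayer_op s f) sequentially"
proof -
  note r2 = golden_less_2[OF assms(2)]
  obtain \<rho> where \<rho>: "0 < \<rho>" "\<rho> < r"
    "\<And>n z. z \<in> cball 1 r \<Longrightarrow> 1 / (z + of_nat (Suc n)) \<in> cball (1::complex) \<rho>"
    using mayer_branch_contraction[OF assms(1,2)] by blast
  obtain C where C: "0 < C"
    "\<And>f B z. z \<in> cball 1 r \<Longrightarrow> (\<And>n. norm (f (1 / (z + of_nat (Suc n)))) \<le> B) \<Longrightarrow>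
       norm (mayer_op s f z) \<le> C * B"
    using mayer_op_bound[OF _ r2 assms(3)] assms(1) by (metis less_trans zero_less_one)
  define T where "T n z = (1 / (z + of_nat (Suc n))) powr (2 * s)" for n z
  define h where "h n z = 1 / (z + of_nat (Suc n) :: complex)" for n z
  \<comment> \<open>\<open>suminf\<close> obeys linearity only for convergent series. This supplies
    convergence for each function bounded on the smaller disc: partial sums, \<open>f\<close> and
    their difference.\<close>
  have sums: "(\<lambda>n. T n z * g (h n z)) sums mayer_op s g z"
    if "\<And>w. w \<in> cball 1 \<rho> \<Longrightarrow> norm (g w) \<le> B" "z \<in> cball 1 r" for g B z
    unfolding sums_def T_def h_def
    
    by (rule tendsto_uniform_limitI[OF mayer_op_uniform_limit[OF r2 assms(3), of g B] that(2)])
      (rule that(1), rule \<rho>(3))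
  define P where "P K w = (\<Sum>k<K. c k * (w - 1) ^ k)" for K and w :: complex
  \<comment> \<open>Convergence at the intermediate point 1 + \<open>r'\<close> forces absolute
    convergence at radius \<open>\<rho>\<close>, which provides the majorant for the M-test.\<close>
  obtain r' where r': "\<rho> < r'" "r' < r" using dense \<rho>(2) by blast
  have "summable (\<lambda>k. c k * of_real r' ^ k)"
    using sums_summable[OF f[of "1 + of_real r'"]] r' \<rho> by (simp add: dist_norm)
  then have "summable (\<lambda>k. norm (c k * of_real \<rho> ^ k))"
    by (rule powser_insidea) (use r' \<rho> in simp)
  then have summ: "summable (\<lambda>k. norm (c k) * \<rho> ^ k)"
    using \<rho> by (simp add: norm_mult norm_power)
  have f_eq: "f w = (\<Sum>k. c k * (w - 1) ^ k)" if "w \<in> cball 1 \<rho>" for w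
    using f[of w] that \<rho> by (intro sums_unique) auto
  have "uniform_limit (cball 1 \<rho>) P (\<lambda>w. \<Sum>k. c k * (w - 1) ^ k) sequentially"
    unfolding P_def
    by (rule Weierstrass_m_test[OF _ summ])
      (auto simp: norm_mult intro!: mult_left_mono norm_shifted_power_le)
  then have limP: "uniform_limit (cball 1 \<rho>) P f sequentially"
    by (rule uniform_limit_cong'[THEN iffD1, rotated 2]) (auto simp: f_eq)
  have Pbd: "norm (P K w) \<le> (\<Sum>k<K. norm (c k) * \<rho> ^ k)" if "w \<in> cball 1 \<rho>" for K w
    unfolding P_def using that
    by (intro order_trans[OF norm_sum] sum_mono)
      (auto simp: norm_mult intro!: mult_left_mono norm_shifted_power_le)
  have LP: "mayer_op s (P K) z = (\<Sum>k<K. c k * mayer_op s (\<lambda>w. (w - 1) ^ k) z)"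
    if z: "z \<in> cball 1 r" for K z
  proof -
    have "(\<lambda>n. \<Sum>k<K. c k * (T n z * (h n z - 1) ^ k)) sums
        (\<Sum>k<K. c k * mayer_op s (\<lambda>w. (w - 1) ^ k) z)"
      by (intro sums_sum sums_mult sums[OF norm_shifted_power_le z])
    moreover have "(\<lambda>n. \<Sum>k<K. c k * (T n z * (h n z - 1) ^ k)) = (\<lambda>n. T n z * P K (h n z))"
      by (simp add: P_def sum_distrib_left mult_ac)
    ultimately have "(\<lambda>n. T n z * P K (h n z)) sums (\<Sum>k<K. c k * mayer_op s (\<lambda>w. (w - 1) ^ k) z)"
      by (simp only:)
    from sums_unique2[OF sums[OF Pbd z] this] show ?thesis .
  qed
  show ?thesis
  proof (rule uniform_limitI)
    fix e :: real assume e: "e > 0"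
    \<comment> \<open>The factor 2 turns the non-strict operator bound into the strict inequality
      required.\<close>
    define \<epsilon> where "\<epsilon> = e / (2 * C)"
    have eps: "\<epsilon> > 0" "C * \<epsilon> < e" using e C(1) by (auto simp: \<epsilon>_def field_simps)
    have "\<forall>\<^sub>F K in sequentially. \<forall>w\<in>cball 1 \<rho>. dist (P K w) (f w) < \<epsilon>"
      using uniform_limitD[OF limP eps(1)] .
    then show "\<forall>\<^sub>F K in sequentially. \<forall>z\<in>ball 1 r.
        dist (\<Sum>k<K. c k * mayer_op s (\<lambda>w. (w - 1) ^ k) z) (mayer_op s f z) < e"
    proof (eventually_elim, safe)
      fix K z assume K: "\<forall>w\<in>cball 1 \<rho>. dist (P K w) (f w) < \<epsilon>" and "z \<in> ball (1::complex) r"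
      then have z: "z \<in> cball 1 r" by auto
      have Kle: "norm (P K w - f w) \<le> \<epsilon>" if "w \<in> cball 1 \<rho>" for w
        using K that by (auto simp: dist_norm less_imp_le)
      \<comment> \<open>A bound on \<open>f\<close> comes from its closeness to the bounded
        polynomial \<open>P K\<close>.\<close>
      have fbd: "norm (f w) \<le> (\<Sum>k<K. norm (c k) * \<rho> ^ k) + \<epsilon>" if "w \<in> cball 1 \<rho>" for w
        using Kle[OF that] Pbd[OF that, of K] norm_triangle_ineq4[of "P K w" "P K w - f w"] by simp
      have "(\<lambda>n. T n z * P K (h n z) - T n z * f (h n z)) sums (mayer_op s (P K) z - mayer_op s f z)"
        by (intro sums_diff sums[OF Pbd z] sums[OF fbd z])
      moreover have "(\<lambda>n. T n z * (P K (h n z) - f (h n z))) sums mayer_op s (\<lambda>w. P K w - f w) z"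
        by (rule sums[OF Kle z])
      ultimately have "mayer_op s (P K) z - mayer_op s f z = mayer_op s (\<lambda>w. P K w - f w) z"
        unfolding right_diff_distrib by (rule sums_unique2)
      then have "norm (mayer_op s (P K) z - mayer_op s f z) \<le> C * \<epsilon>"
        using C(2)[OF z, of "\<lambda>w. P K w - f w" \<epsilon>] Kle[OF \<rho>(3)[OF z]] by simp
      then show "dist (\<Sum>k<K. c k * mayer_op s (\<lambda>w. (w - 1) ^ k) z) (mayer_op s f z) < e"
        using eps(2) LP[OF z] by (simp add: dist_norm)
    qed
  qed
qed

section \<open>Comparison of Taylor coefficients\<close>

theorem lemma3:
  fixes r :: real and s :: complex
  assumes "1 < r" and "r < (1 + sqrt 5) / 2" and "Re s > 1 / 2"
  shows
    "(\<forall>f \<mu> c. mayer_eigenfunction r s \<mu> f \<longrightarrow>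
        (\<forall>z\<in>ball 1 r. (\<lambda>k. c k * (z - 1) ^ k) sums f z) \<longrightarrow>
        (\<forall>m. (\<lambda>k. mayer_coeff s m k * c k) sums (\<mu> * c m))) \<and>
     (\<forall>k. \<forall>z\<in>ball 1 r.
        (\<lambda>m. mayer_coeff s m k * (z - 1) ^ m) sums mayer_op s (\<lambda>w. (w - 1) ^ k) z)"
proof (intro conjI allI impI ballI)
  fix k z assume "z \<in> ball (1::complex) r"
  from holomorphic_power_series[OF mayer_op_shifted_power(1)[OF assms] this]
  show "(\<lambda>m. mayer_coeff s m k * (z - 1) ^ m) sums mayer_op s (\<lambda>w. (w - 1) ^ k) z"
    by (simp add: mayer_op_shifted_power(2)[OF assms])
next
  fix f \<mu> c m
  assume eig: "mayer_eigenfunction r s \<mu> f"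
    and f: "\<forall>z\<in>ball 1 r. (\<lambda>k. c k * (z - 1) ^ k) sums f z"
  let ?L = "\<lambda>k. mayer_op s (\<lambda>w. (w - 1) ^ k)"
  have hol: "(\<lambda>z. c k * ?L k z) holomorphic_on ball 1 r" for k
    by (intro holomorphic_intros mayer_op_shifted_power(1)[OF assms])
  \<comment> \<open>The \<open>m\<close>-th derivative of the image of \<open>f\<close> at 1 is
    computed twice: here as a sum over \<open>k\<close> of matrix entries, below from the expansion
    of \<mu> f.\<close>
  have "(\<lambda>k. (deriv ^^ m) (\<lambda>z. c k * ?L k z) 1) sums (deriv ^^ m) (mayer_op s f) 1"
    by (rule higher_deriv_sums_uniform[OF hol _ _ mayer_op_power_series[OF assms]])
      (use assms f in auto)
  moreover have "(deriv ^^ m) (\<lambda>z. c k * ?L k z) 1 = fact m * (mayer_coeff s m k * c k)" for k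
    using higher_deriv_cmult[OF mayer_op_shifted_power(1)[OF assms], of 1 m "c k" k] assms(1)
    by (simp add: mayer_op_shifted_power(2)[OF assms] mult_ac)
  moreover have "(deriv ^^ m) (mayer_op s f) 1 = fact m * (\<mu> * c m)"
  proof (rule power_series_coeff_eq_higher_deriv)
    show "0 < r" using assms by simp
    fix w :: complex assume w: "w \<in> ball 1 r"
    then have "mayer_op s f w = \<mu> * f w"
      using eig by (auto simp: mayer_eigenfunction_def)
    then show "(\<lambda>k. \<mu> * c k * (w - 1) ^ k) sums mayer_op s f w"
      using sums_mult[OF f[rule_format, OF w], of \<mu>] by (simp add: mult_ac)
  qed
  ultimately have "(\<lambda>k. fact m * (mayer_coeff s m k * c k)) sums (fact m * (\<mu> * c m))"
    by simp
  then show "(\<lambda>k. mayer_coeff s m k * c k) sums (\<mu> * c m)"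
    by (subst (asm) sums_mult_iff) auto
qed

end
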